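(* Let $(X,d)$ be a complete $\mathrm{CAT}(0)$ space. (i) Let $K\subseteq X$ be compact. If $\deg_{\operatorname{thr}}K$ is finite then $\operatorname{co}K$ is compact. (ii) If $X$ is of finite type then $\operatorname{co}K$ is compact whenever $K\subseteq X$ is compact.
   Context: A $\mathrm{CAT}(0)$ space is a geodesic metric space in which every geodesic triangle is at least as thin as its Euclidean comparison triangle; it is uniquely geodesic, and $[x,y]$ denotes the geodesic segment joining $x$ and $y$. A set $C\subseteq X$ is convex if $[x,y]\subseteq C$ for all $x,y\in C$; $\operatorname{co}S$ is the smallest convex set containing $S$. The threading of $S\subseteq X$ is $\operatorname{thr}S:=\bigcup_{x,y\in S}[x,y]$, and iteratively $\operatorname{thr}^1S=\operatorname{thr}S$, $\operatorname{thr}^nS=\operatorname{thr}(\operatorname{thr}^{n-1}S)$; $\mathbb N=\{1,2,\dots\}$. The threading degree $\deg_{\operatorname{thr}}S$ is the smallest $n\in\mathbb N$ with $\operatorname{thr}^nS=\operatorname{co}S$ if such $n$ exists, and $+\infty$ otherwise. Put $\deg_{\operatorname{thr}}X:=\sup_{S\subseteq X}\deg_{\operatorname{thr}}S$; $X$ is of finite type if $\deg_{\operatorname{thr}}X<+\infty$. *)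

theory Defs
  imports "HOL-Analysis.Analysis"
begin

text \<open>A metric space is a set \<open>X\<close> in a type of class \<^class>\<open>metric_space\<close>, with the restricted
  metric; everything below is relative to \<open>X\<close>, and geodesics run inside \<open>X\<close>.\<close>

definition geodesic_path :: "'a::metric_space set \<Rightarrow> 'a \<Rightarrow> 'a \<Rightarrow> (real \<Rightarrow> 'a) \<Rightarrow> bool" where
  "geodesic_path X x y g \<longleftrightarrow>
     g ` {0..dist x y} \<subseteq> X \<and> g 0 = x \<and> g (dist x y) = y \<and>
     (\<forall>s\<in>{0..dist x y}. \<forall>t\<in>{0..dist x y}. dist (g s) (g t) = \<bar>s - t\<bar>)"

definition is_geodesic_segment :: "'a::metric_space set \<Rightarrow> 'a \<Rightarrow> 'a \<Rightarrow> 'a set \<Rightarrow> bool" where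
  "is_geodesic_segment X x y G \<longleftrightarrow> (\<exists>g. geodesic_path X x y g \<and> G = g ` {0..dist x y})"

definition geodesic_space :: "'a::metric_space set \<Rightarrow> bool" where
  "geodesic_space X \<longleftrightarrow> (\<forall>x\<in>X. \<forall>y\<in>X. \<exists>G. is_geodesic_segment X x y G)"

definition geodesic_triangle ::
  "'a::metric_space set \<Rightarrow> 'a \<Rightarrow> 'a \<Rightarrow> 'a \<Rightarrow> 'a set \<Rightarrow> 'a set \<Rightarrow> 'a set \<Rightarrow> bool" where
  "geodesic_triangle X x y z A B C \<longleftrightarrow>
     x \<in> X \<and> y \<in> X \<and> z \<in> X \<and>
     is_geodesic_segment X x y A \<and> is_geodesic_segment X y z B \<and> is_geodesic_segment X z x C"

definition comparison_triangle ::
  "'a::metric_space \<Rightarrow> 'a \<Rightarrow> 'a \<Rightarrow> real^2 \<Rightarrow> real^2 \<Rightarrow> real^2 \<Rightarrow> bool" where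
  "comparison_triangle x y z x' y' z' \<longleftrightarrow>
     dist x' y' = dist x y \<and> dist y' z' = dist y z \<and> dist z' x' = dist z x"

text \<open>\<open>p'\<close> is the comparison point, on the Euclidean side from \<open>x'\<close> to \<open>y'\<close>, of the point \<open>p\<close>
  on the side \<open>A\<close> from \<open>x\<close> to \<open>y\<close>.\<close>

definition comparison_point ::
  "'a::metric_space \<Rightarrow> 'a set \<Rightarrow> real^2 \<Rightarrow> real^2 \<Rightarrow> 'a \<Rightarrow> real^2 \<Rightarrow> bool" where
  "comparison_point x A x' y' p p' \<longleftrightarrow>
     p \<in> A \<and> p' \<in> closed_segment x' y' \<and> dist x' p' = dist x p"

definition cat0_space :: "'a::metric_space set \<Rightarrow> bool" where
  "cat0_space X \<longleftrightarrow> geodesic_space X \<and>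
     (\<forall>x y z A B C x' y' z'.
        geodesic_triangle X x y z A B C \<longrightarrow> comparison_triangle x y z x' y' z' \<longrightarrow>
        (let cmp = (\<lambda>p p'. comparison_point x A x' y' p p' \<or>
                           comparison_point y B y' z' p p' \<or>
                           comparison_point z C z' x' p p')
         in \<forall>p q p' q'. cmp p p' \<longrightarrow> cmp q q' \<longrightarrow> dist p q \<le> dist p' q'))"

text \<open>The segment \<open>[x,y]\<close>; meaningful for \<open>x, y \<in> X\<close> when \<open>X\<close> is uniquely geodesic.\<close>

definition geodesic_segment :: "'a::metric_space set \<Rightarrow> 'a \<Rightarrow> 'a \<Rightarrow> 'a set" where
  "geodesic_segment X x y = (THE G. is_geodesic_segment X x y G)"

definition geodesically_convex :: "'a::metric_space set \<Rightarrow> 'a set \<Rightarrow> bool" where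
  "geodesically_convex X C \<longleftrightarrow> C \<subseteq> X \<and> (\<forall>x\<in>C. \<forall>y\<in>C. geodesic_segment X x y \<subseteq> C)"

definition geodesic_hull :: "'a::metric_space set \<Rightarrow> 'a set \<Rightarrow> 'a set" where
  "geodesic_hull X S = geodesically_convex X hull S"

definition threading :: "'a::metric_space set \<Rightarrow> 'a set \<Rightarrow> 'a set" where
  "threading X S = (\<Union>x\<in>S. \<Union>y\<in>S. geodesic_segment X x y)"

text \<open>The degree ranges over \<open>n \<ge> 1\<close>: even a convex set has threading degree 1.\<close>

definition threading_degree :: "'a::metric_space set \<Rightarrow> 'a set \<Rightarrow> enat" where
  "threading_degree X S =
     (if \<exists>n\<ge>1. (threading X ^^ n) S = geodesic_hull X S
      then enat (LEAST n. n \<ge> 1 \<and> (threading X ^^ n) S = geodesic_hull X S)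
      else \<infinity>)"

definition space_threading_degree :: "'a::metric_space set \<Rightarrow> enat" where
  "space_threading_degree X = (SUP S\<in>Pow X. threading_degree X S)"

definition finite_type :: "'a::metric_space set \<Rightarrow> bool" where
  "finite_type X \<longleftrightarrow> space_threading_degree X < \<infinity>"

end

theory Submission
  imports Defs
begin

text \<open>By comparison, the point dividing \<open>[x,y]\<close> in the ratio \<open>t : 1 - t\<close> depends continuously on
  \<open>(x, y, t)\<close>, so the threading of a compact set \<open>K\<close> is the continuous image of
  \<open>K \<times> K \<times> {0..1}\<close>. Hence every iterated threading of \<open>K\<close> is compact, and a finite threading
  degree means that the hull is one of them.\<close>

section \<open>Euclidean comparison triangles\<close>

lemma comparison_triangle_exists:
  fixes x y z :: "'a::metric_space"
  obtains x' y' z' where "comparison_triangle x y z x' y' z'"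
proof (cases "x = y")
  case True
  \<comment> \<open>With \<open>x = y\<close> the triangle degenerates to a segment of length
    \<open>dist x z\<close>; the general construction divides by \<open>dist x y\<close>.\<close>
  have "comparison_triangle x y z 0 0 (vector [dist x z, 0] :: real^2)"
    using True
    by (simp add: comparison_triangle_def dist_norm norm_vec_def L2_set_def sum_2 dist_commute)
  then show thesis by (rule that)
next
  case False
  define c where "c = dist x y"
  define q where "q = dist x z"
  define r where "r = dist y z"
  \<comment> \<open>Put x' at the origin and y' at (c, 0). The law of cosines then forces the first
    coordinate of z' to be \<open>a\<close>, and |z'| = \<open>q\<close> gives the second.\<close>
  define a where "a = (c\<^sup>2 + q\<^sup>2 - r\<^sup>2) / (2 * c)"
  have c: "c > 0" and q: "q \<ge> 0" and r: "r \<ge> 0"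
    using False by (auto simp: c_def q_def r_def)
  have tri: "c \<le> q + r" "q \<le> c + r" "r \<le> c + q"
    unfolding c_def q_def r_def by metric+
  have ac: "2 * a * c = c\<^sup>2 + q\<^sup>2 - r\<^sup>2"
    using c by (simp add: a_def)
  \<comment> \<open>Squared triangle inequalities: they amount to \<bar>a\<bar> \<le> q, so that the
    square root in \<open>z'\<close> has a nonnegative argument.\<close>
  have "(c - q)\<^sup>2 \<le> r\<^sup>2" "r\<^sup>2 \<le> (c + q)\<^sup>2"
    using tri r by (auto simp: abs_le_square_iff[symmetric] abs_le_iff intro: power_mono)
  then have "a * c \<le> q * c" "- q * c \<le> a * c"
    using ac by (auto simp: power2_eq_square algebra_simps)
  then have "a \<le> q" "- q \<le> a"
    using c by (blast intro: mult_right_le_imp_le)+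
  then have aq: "a\<^sup>2 \<le> q\<^sup>2"
    by (simp add: abs_le_square_iff[symmetric])
  define z' :: "real^2" where "z' = vector [a, sqrt (q\<^sup>2 - a\<^sup>2)]"
  have "dist (vector [c, 0]) z' = r"
  proof -
    have "(c - a)\<^sup>2 + (q\<^sup>2 - a\<^sup>2) = r\<^sup>2"
      using ac by (simp add: power2_eq_square algebra_simps)
    then show ?thesis
      using aq r by (simp add: z'_def dist_norm norm_vec_def L2_set_def sum_2)
  qed
  moreover have "dist z' 0 = q"
    using aq q by (simp add: z'_def dist_norm norm_vec_def L2_set_def sum_2)
  moreover have "dist 0 (vector [c, 0] :: real^2) = c"
    using c by (simp add: dist_norm norm_vec_def L2_set_def sum_2)
  ultimately have "comparison_triangle x y z 0 (vector [c, 0]) z'"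
    by (simp add: comparison_triangle_def c_def q_def r_def dist_commute)
  then show thesis by (rule that)
qed

section \<open>Geodesics: reversal, comparison and uniqueness\<close>

lemma geodesic_path_rev:
  assumes "geodesic_path X x y g"
  shows "geodesic_path X y x (\<lambda>s. g (dist x y - s))"
  using assms by (auto simp: geodesic_path_def dist_commute)

lemma geodesic_path_rev_image:
  "(\<lambda>s. g (dist x y - s)) ` {0..dist y x} = g ` {0..dist x y}"
proof -
  have "(\<lambda>s. dist x y - s) ` {0..dist y x} = {0..dist x y}"
    by (simp add: dist_commute)
  then show ?thesis
    by (metis image_image)
qed

lemma geodesic_path_endpoints:
  assumes "geodesic_path X x y g"
  shows "x \<in> X" "y \<in> X"
proof -
  have "0 \<in> {0..dist x y}" "dist x y \<in> {0..dist x y}"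
    by auto
  then have "g 0 \<in> X" "g (dist x y) \<in> X"
    using assms unfolding geodesic_path_def by blast+
  then show "x \<in> X" "y \<in> X"
    using assms by (auto simp: geodesic_path_def)
qed

lemma geodesic_path_dist_scaled:
  assumes g: "geodesic_path X x y g" and "0 \<le> s" "s \<le> 1" "0 \<le> t" "t \<le> 1"
  shows "dist (g (s * dist x y)) (g (t * dist x y)) = \<bar>s - t\<bar> * dist x y"
proof -
  have "s * dist x y \<in> {0..dist x y}" "t * dist x y \<in> {0..dist x y}"
    using assms by (auto simp: mult_left_le_one_le)
  then have "dist (g (s * dist x y)) (g (t * dist x y)) = \<bar>s * dist x y - t * dist x y\<bar>"
    using g by (simp add: geodesic_path_def)
  also have "\<dots> = \<bar>s - t\<bar> * dist x y"
    by (simp flip: left_diff_distrib add: abs_mult)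
  finally show ?thesis .
qed

text \<open>The comparison points divide the two Euclidean sides at x' in the same ratio, so by
  similarity their distance is exactly t times the opposite side. The case y = z is allowed and
  yields uniqueness of geodesics.\<close>

lemma cat0_geodesics_from_common_point:
  assumes X: "cat0_space X"
    and g: "geodesic_path X x y g" and h: "geodesic_path X x z h"
    and t: "0 \<le> t" "t \<le> 1"
  shows "dist (g (t * dist x y)) (h (t * dist x z)) \<le> t * dist y z"
proof -
  note in_X = geodesic_path_endpoints[OF g] geodesic_path_endpoints[OF h]
  define A where "A = g ` {0..dist x y}"
  define C where "C = h ` {0..dist x z}"
  obtain B where "is_geodesic_segment X y z B"
    using X in_X unfolding cat0_space_def geodesic_space_def by blast
  moreover have "is_geodesic_segment X x y A"
    using g by (auto simp: is_geodesic_segment_def A_def)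
  \<comment> \<open>The third side of a triangle runs from \<open>z\<close> to \<open>x\<close>, so
    \<open>h\<close> is reversed; the comparison point of its point at ratio t is therefore measured
    from z', at ratio 1 - t.\<close>
  moreover have "is_geodesic_segment X z x C"
    unfolding is_geodesic_segment_def C_def
    using geodesic_path_rev[OF h] geodesic_path_rev_image[of h x z] by metis
  ultimately have tri: "geodesic_triangle X x y z A B C"
    using in_X by (simp add: geodesic_triangle_def)
  obtain x' y' z' where cmp: "comparison_triangle x y z x' y' z'"
    by (rule comparison_triangle_exists)
  define p' where "p' = x' + t *\<^sub>R (y' - x')"
  define q' where "q' = x' + t *\<^sub>R (z' - x')"
  have p: "comparison_point x A x' y' (g (t * dist x y)) p'"
  proof -
    have "g (t * dist x y) \<in> A"
      using t by (auto simp: A_def mult_left_le_one_le)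
    moreover have "p' \<in> closed_segment x' y'"
      using t by (auto simp: in_segment p'_def algebra_simps intro!: exI[of _ t])
    moreover have "dist x' p' = t * dist x' y'"
      using t by (simp add: p'_def dist_norm norm_minus_commute)
    moreover have "dist x (g (t * dist x y)) = t * dist x y"
      using geodesic_path_dist_scaled[OF g, of 0 t] g t by (simp add: geodesic_path_def)
    ultimately show ?thesis
      using cmp by (simp add: comparison_point_def comparison_triangle_def)
  qed
  have q: "comparison_point z C z' x' (h (t * dist x z)) q'"
  proof -
    have "h (t * dist x z) \<in> C"
      using t by (auto simp: C_def mult_left_le_one_le)
    moreover have "q' \<in> closed_segment z' x'"
      using t by (auto simp: in_segment q'_def algebra_simps intro!: exI[of _ "1 - t"])
    moreover have "dist z' q' = (1 - t) * dist z' x'"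
    proof -
      have "z' - q' = (1 - t) *\<^sub>R (z' - x')"
        by (simp add: q'_def algebra_simps)
      then show ?thesis
        using t by (simp add: dist_norm)
    qed
    moreover have "dist z (h (t * dist x z)) = (1 - t) * dist z x"
      using geodesic_path_dist_scaled[OF h, of 1 t] h t
      by (simp add: geodesic_path_def dist_commute)
    ultimately show ?thesis
      using cmp by (simp add: comparison_point_def comparison_triangle_def)
  qed
  have "dist (g (t * dist x y)) (h (t * dist x z)) \<le> dist p' q'"
    using X tri cmp p q unfolding cat0_space_def Let_def by blast
  also have "\<dots> = t * dist y' z'"
  proof -
    have "p' - q' = t *\<^sub>R (y' - z')"
      by (simp add: p'_def q'_def algebra_simps)
    then show ?thesis
      using t by (simp add: dist_norm)
  qed
  finally show ?thesis
    using cmp by (simp add: comparison_triangle_def)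
qed

text \<open>Parametrising proportionally to arc length gives all pairs of endpoints the common
  parameter interval [0,1], so that continuity in all three arguments makes sense. The choice of
  path is harmless in a CAT(0) space by \<open>geodesic_point_eq\<close>.\<close>

definition geodesic_point :: "'a::metric_space set \<Rightarrow> 'a \<Rightarrow> 'a \<Rightarrow> real \<Rightarrow> 'a" where
  "geodesic_point X x y t = (SOME g. geodesic_path X x y g) (t * dist x y)"

text \<open>Compare the chosen path with \<open>g\<close>: both run from x to y, so the bound is t *
  \<open>dist y y\<close> = 0.\<close>

lemma geodesic_point_eq:
  assumes X: "cat0_space X" and g: "geodesic_path X x y g" and t: "0 \<le> t" "t \<le> 1"
  shows "geodesic_point X x y t = g (t * dist x y)"
  using cat0_geodesics_from_common_point[OF X someI[where P = "geodesic_path X x y", OF g] g t]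
  by (simp add: geodesic_point_def)

lemma cat0_geodesic_path_exists:
  assumes "cat0_space X" "x \<in> X" "y \<in> X"
  obtains g where "geodesic_path X x y g"
  using assms unfolding cat0_space_def geodesic_space_def is_geodesic_segment_def by blast

lemma geodesic_path_image:
  assumes "cat0_space X" and g: "geodesic_path X x y g"
  shows "g ` {0..dist x y} = geodesic_point X x y ` {0..1}"
proof -
  have "(\<lambda>t. t * dist x y) ` {0..1} = {0..dist x y}"
    by (cases "x = y") (simp_all add: image_constant_conv image_mult_atLeastAtMost_if')
  then have "g ` {0..dist x y} = (\<lambda>t. g (t * dist x y)) ` {0..1}"
    by (metis image_image)
  also have "\<dots> = geodesic_point X x y ` {0..1}"
    using geodesic_point_eq[OF assms] by (intro image_cong) auto
  finally show ?thesis .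
qed

text \<open>Every geodesic from x to y has this same image, so the description by \<open>THE\<close>
  is well defined.\<close>

lemma geodesic_segment_eq:
  assumes X: "cat0_space X" and "x \<in> X" "y \<in> X"
  shows "geodesic_segment X x y = geodesic_point X x y ` {0..1}"
  unfolding geodesic_segment_def
proof (rule the_equality)
  show "is_geodesic_segment X x y (geodesic_point X x y ` {0..1})"
    using cat0_geodesic_path_exists[OF assms] geodesic_path_image[OF X]
    unfolding is_geodesic_segment_def by metis
qed (use geodesic_path_image[OF X] in \<open>unfold is_geodesic_segment_def, blast\<close>)

lemma geodesic_point_in:
  assumes X: "cat0_space X" and "x \<in> X" "y \<in> X" and t: "0 \<le> t" "t \<le> 1"
  shows "geodesic_point X x y t \<in> X"
proof -
  obtain g where g: "geodesic_path X x y g"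
    using assms by (rule_tac cat0_geodesic_path_exists)
  then show ?thesis
    using geodesic_path_image[OF X g] t unfolding geodesic_path_def by auto
qed

lemma geodesic_point_commute:
  assumes X: "cat0_space X" and "x \<in> X" "y \<in> X" and t: "0 \<le> t" "t \<le> 1"
  shows "geodesic_point X y x (1 - t) = geodesic_point X x y t"
proof -
  obtain g where g: "geodesic_path X x y g"
    using assms by (rule_tac cat0_geodesic_path_exists)
  show ?thesis
    using geodesic_point_eq[OF X g t] geodesic_point_eq[OF X geodesic_path_rev[OF g], of "1 - t"] t
    by (simp add: dist_commute algebra_simps)
qed

section \<open>Joint continuity in the endpoints and the parameter\<close>

lemma dist_geodesic_point_right:
  assumes X: "cat0_space X" and "x \<in> X" "y \<in> X" "z \<in> X" and t: "0 \<le> t" "t \<le> 1"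
  shows "dist (geodesic_point X x y t) (geodesic_point X x z t) \<le> dist y z"
proof -
  obtain g where g: "geodesic_path X x y g"
    using assms by (rule_tac cat0_geodesic_path_exists)
  obtain h where h: "geodesic_path X x z h"
    using assms by (rule_tac cat0_geodesic_path_exists)
  have "dist (geodesic_point X x y t) (geodesic_point X x z t) \<le> t * dist y z"
    using cat0_geodesics_from_common_point[OF X g h t]
      geodesic_point_eq[OF X g t] geodesic_point_eq[OF X h t] by simp
  also have "\<dots> \<le> dist y z"
    using t by (simp add: mult_left_le_one_le)
  finally show ?thesis .
qed

text \<open>Change one argument at a time: (u, v, s), (u, y, s), (x, y, s), (x, y, t). The parameter
  moves last, so its coefficient \<open>dist x y\<close> involves only the limit point.\<close>

lemma dist_geodesic_point_le:
  assumes X: "cat0_space X" and in_X: "x \<in> X" "y \<in> X" "u \<in> X" "v \<in> X"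
    and s: "0 \<le> s" "s \<le> 1" and t: "0 \<le> t" "t \<le> 1"
  shows "dist (geodesic_point X u v s) (geodesic_point X x y t)
    \<le> dist u x + dist v y + \<bar>s - t\<bar> * dist x y"
proof -
  have "dist (geodesic_point X u v s) (geodesic_point X u y s) \<le> dist v y"
    using dist_geodesic_point_right[OF X _ _ _ s] in_X by blast
  \<comment> \<open>Reversing both segments turns a moving left endpoint into a moving right one, at
    parameter 1 - s.\<close>
  moreover have "dist (geodesic_point X u y s) (geodesic_point X x y s) \<le> dist u x"
    using dist_geodesic_point_right[OF X, of y u x "1 - s"] s
      geodesic_point_commute[OF X _ _ s] in_X by simp
  moreover have "dist (geodesic_point X x y s) (geodesic_point X x y t) = \<bar>s - t\<bar> * dist x y"
  proof -
    obtain g where g: "geodesic_path X x y g"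
      using X in_X by (rule_tac cat0_geodesic_path_exists)
    show ?thesis
      using geodesic_path_dist_scaled[OF g s t] geodesic_point_eq[OF X g] s t by simp
  qed
  ultimately show ?thesis
    using dist_triangle[of "geodesic_point X u v s" "geodesic_point X x y t" "geodesic_point X u y s"]
      dist_triangle[of "geodesic_point X u y s" "geodesic_point X x y t" "geodesic_point X x y s"]
    by linarith
qed

lemma continuous_on_geodesic_point:
  assumes X: "cat0_space X"
  shows "continuous_on (X \<times> X \<times> {0..1}) (\<lambda>(x, y, t). geodesic_point X x y t)"
    (is "continuous_on ?D ?f")
  unfolding continuous_on_def
proof
  fix w assume w: "w \<in> ?D"
  \<comment> \<open>The estimate \<open>dist_geodesic_point_le\<close> with \<open>w\<close> as the
    fixed triple. It is continuous in \<open>v\<close> and vanishes at \<open>w\<close>, so it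
    squeezes the distance to 0.\<close>
  define b where
    "b v = dist (fst v) (fst w) + dist (fst (snd v)) (fst (snd w))
      + \<bar>snd (snd v) - snd (snd w)\<bar> * dist (fst w) (fst (snd w))" for v
  have b: "(b \<longlongrightarrow> 0) (at w within ?D)"
  proof -
    have "(b \<longlongrightarrow> b w) (at w within ?D)"
      unfolding b_def by (intro tendsto_intros)
    then show ?thesis
      by (simp add: b_def)
  qed
  have "\<forall>\<^sub>F v in at w within ?D. dist (?f v) (?f w) \<le> b v"
    unfolding eventually_at_filter
    using w by (intro always_eventually) (auto simp: b_def intro: dist_geodesic_point_le[OF X])
  then have "((\<lambda>v. dist (?f v) (?f w)) \<longlongrightarrow> 0) (at w within ?D)"
    by (intro tendsto_sandwich[OF _ _ tendsto_const b]) auto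
  then show "(?f \<longlongrightarrow> ?f w) (at w within ?D)"
    by (rule tendsto_dist_iff[THEN iffD2])
qed

section \<open>Compactness of iterated threadings\<close>

lemma threading_eq:
  assumes X: "cat0_space X" and S: "S \<subseteq> X"
  shows "threading X S = (\<lambda>(x, y, t). geodesic_point X x y t) ` (S \<times> S \<times> {0..1})"
proof -
  have "threading X S = (\<Union>x\<in>S. \<Union>y\<in>S. geodesic_point X x y ` {0..1})"
    unfolding threading_def using S
    by (intro SUP_cong refl geodesic_segment_eq[OF X]) auto
  then show ?thesis
    by (force simp: image_iff)
qed

lemma threading_subset:
  assumes "cat0_space X" "S \<subseteq> X"
  shows "threading X S \<subseteq> X"
  using assms by (auto simp: threading_eq intro!: geodesic_point_in)

lemma compact_threading:
  assumes X: "cat0_space X" and K: "K \<subseteq> X" "compact K"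
  shows "compact (threading X K)"
  unfolding threading_eq[OF X K(1)]
proof (rule compact_continuous_image)
  show "continuous_on (K \<times> K \<times> {0..1}) (\<lambda>(x, y, t). geodesic_point X x y t)"
    using K(1) by (intro continuous_on_subset[OF continuous_on_geodesic_point[OF X]]) auto
qed (intro compact_Times K compact_Icc)

text \<open>The inclusion in X is carried through the induction because
  \<open>compact_threading\<close> asks for it at each step.\<close>

lemma compact_funpow_threading:
  assumes "cat0_space X" "K \<subseteq> X" "compact K"
  shows "(threading X ^^ n) K \<subseteq> X \<and> compact ((threading X ^^ n) K)"
  using assms by (induction n) (simp_all add: compact_threading threading_subset)

lemma threading_degree_finite_iff:
  "threading_degree X S < \<infinity> \<longleftrightarrow> (\<exists>n\<ge>1. (threading X ^^ n) S = geodesic_hull X S)"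
  by (simp add: threading_degree_def)

theorem corollary6:
  fixes X :: "'a::metric_space set"
  assumes "cat0_space X" and "complete X"
  shows "(\<forall>K. K \<subseteq> X \<longrightarrow> compact K \<longrightarrow> threading_degree X K < \<infinity> \<longrightarrow> compact (geodesic_hull X K)) \<and>
         (finite_type X \<longrightarrow> (\<forall>K. K \<subseteq> X \<longrightarrow> compact K \<longrightarrow> compact (geodesic_hull X K)))"
proof -
  have *: "compact (geodesic_hull X K)"
    if "K \<subseteq> X" "compact K" "threading_degree X K < \<infinity>" for K
    using that compact_funpow_threading[OF assms(1)] by (metis threading_degree_finite_iff)
  moreover have "threading_degree X K < \<infinity>" if "finite_type X" "K \<subseteq> X" for K
  proof -
    \<comment> \<open>The degree of K is one of the terms of the supremum, so finite type reduces
      the second claim to the first.\<close>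
    have "threading_degree X K \<le> space_threading_degree X"
      unfolding space_threading_degree_def using that by (intro SUP_upper) simp
    then show ?thesis
      using that unfolding finite_type_def by (rule_tac le_less_trans)
  qed
  ultimately show ?thesis
    by blast
qed

end
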